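(* Let $x_1,\ldots,x_N$ be unit vectors in $\mathbb{R}^2$ and let $\mathbf{A}=(\langle x_i,x_j\rangle)_{i,j=1}^N$ be their Gram matrix. Then for every $p\in(0,1.3]$, $$E_p(\mathbf{A})\geq \frac{N(N-2)}{2}\ \text{ if } N \text{ is even},\qquad E_p(\mathbf{A})\geq\frac{(N-1)^2}{2}\ \text{ if } N\text{ is odd}.$$
   Context: For a real $N\times N$ matrix $\mathbf{A}=(A_{ij})$ and $p>0$, the $p$-frame energy is $E_p(\mathbf{A})=\sum_{i\neq j}|A_{ij}|^p$, the sum running over all ordered pairs $(i,j)$ with $1\le i,j\le N$, $i\neq j$. The vectors $x_i$ need not be distinct. *)

theory Defs
  imports "HOL-Analysis.Analysis"
begin

definition gram_matrix :: "('n::finite \<Rightarrow> 'a::real_inner) \<Rightarrow> real ^ 'n ^ 'n" where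
  "gram_matrix x = (\<chi> i j. x i \<bullet> x j)"

text \<open>
  The sum runs over ordered pairs of distinct indices.  The energy is meant for \<open>p > 0\<close>,
  where \<open>0 powr p = 0\<close> agrees with the usual value of a power of zero.
\<close>
definition frame_energy :: "real \<Rightarrow> real ^ 'n ^ 'n \<Rightarrow> real" where
  "frame_energy p A = (\<Sum>(i, j) \<in> {(i, j). i \<noteq> j}. \<bar>A $ i $ j\<bar> powr p)"

end

theory Submission
  imports Defs
begin

text \<open>
  Since \<open>\<bar>t\<bar> powr p\<close> decreases in \<open>p\<close> for \<open>\<bar>t\<bar> \<le> 1\<close>, it suffices to treat the exponent \<open>4/3\<close>.
  Doubling the angles turns the lines spanned by the \<open>x i\<close> into unit vectors \<open>v i\<close> of the plane
  with \<open>(x i \<bullet> x j)\<^sup>2 = (1 + v i \<bullet> v j) / 2\<close>.  Write \<open>w\<close> for this square.  The energy is the sum of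
  \<open>w powr (2/3)\<close>, and \<open>w powr (2/3) = w + excess w\<close> with a nonnegative \<open>excess\<close> that vanishes
  only at \<open>0\<close> and \<open>1\<close>, that is, for orthogonal or equal lines.  Summing over all ordered pairs,
  the diagonal included, twice the energy is
  \<open>N\<^sup>2 + R\<^sup>2 + H\<close>, where \<open>R = norm (\<Sum>i. v i)\<close> and \<open>H\<close> is twice the sum of the excesses.
  Dropping \<open>R\<close> and \<open>H\<close> gives the bound for even \<open>N\<close>.  For odd \<open>N\<close> it must be shown that
  \<open>H + R\<^sup>2 \<ge> 1\<close>.

  For odd \<open>N \<ge> 5\<close> (lemma \<open>excess_plus_resultant\<close>) choose signs \<open>s i\<close> for which
  \<open>W = (\<Sum>i. s i *\<^sub>R v i)\<close> is longest, and put \<open>D = N - norm W\<close>; this measures how far the \<open>v i\<close> are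
  from lying on one axis.  A sum of an odd number of signs is at least \<open>1\<close> in absolute value, so
  \<open>R \<ge> 1 - D\<close>, and it remains to bound \<open>H\<close> from below: by \<open>D * (2 - D)\<close> if \<open>D \<le> 1\<close>, and by \<open>1\<close>
  otherwise.  Two estimates together do this.
  Far from an axis, maximality of \<open>W\<close> gives \<open>norm W \<ge> (\<Sum>i. \<bar>v i \<bullet> v k\<bar>)\<close> for every \<open>k\<close>, hence
  \<open>N * D \<le> (\<Sum>i k. 1 - \<bar>v i \<bullet> v k\<bar>)\<close>, and the excess of a pair dominates a multiple of
  \<open>1 - \<bar>v i \<bullet> v k\<bar>\<close>.
  Close to an axis this loses a factor of about \<open>2\<close>, because the axis through a single \<open>v k\<close> is not the
  best one.  There the exact identity
  \<open>D * (2 * N - D) = (\<Sum>i j. 1 - s i * s j * (v i \<bullet> v j))\<close> is used instead; it helps because all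
  the vectors \<open>s i *\<^sub>R v i\<close> then lie close to each other.

  For \<open>N = 3\<close> these estimates are too weak, and the bound follows from the vanishing of the Gram
  determinant of three vectors in the plane (lemma \<open>three_lines\<close>).  For \<open>N = 1\<close> there are no pairs.
\<close>

section \<open>The excess of the cube root squared over the identity\<close>

definition excess :: "real \<Rightarrow> real" where
  "excess w = (root 3 w)\<^sup>2 - w"

lemma excess_cube: "0 \<le> r \<Longrightarrow> excess (r ^ 3) = r\<^sup>2 * (1 - r)"
  using real_root_pos2[of 3 r]
  by (simp add: excess_def algebra_simps power2_eq_square del: power_Suc) (simp add: power3_eq_cube)

lemma excess_nonneg:
  assumes "0 \<le> w" "w \<le> 1"
  shows "0 \<le> excess w"
proof -
  define r where "r = root 3 w"
  have r: "0 \<le> r" "r \<le> 1" "r ^ 3 = w"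
    using assms by (auto simp: r_def)
  have "excess w = r\<^sup>2 * (1 - r)"
    using excess_cube[of r] r by simp
  then show ?thesis using r by simp
qed

text \<open>
  With \<open>w = r ^ 3\<close> the claim is \<open>k * r \<le> 1 - r\<close> up to the factor \<open>r\<^sup>2\<close>, so it holds up to
  the point where \<open>(1 + k) * r = 1\<close>.
\<close>

lemma excess_near_0:
  assumes "0 \<le> w" "0 \<le> k" "(1 + k) ^ 3 * w \<le> 1"
  shows "k * w \<le> excess w"
proof -
  define r where "r = root 3 w"
  have r: "0 \<le> r" "r ^ 3 = w"
    using assms by (auto simp: r_def)
  have "((1 + k) * r) ^ 3 \<le> 1 ^ 3"
    using assms r by (simp add: power_mult_distrib)
  then have "(1 + k) * r \<le> 1"
    using power_mono_iff[of "(1 + k) * r" 1 3] assms r by simp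
  then have "r\<^sup>2 * ((1 + k) * r) \<le> r\<^sup>2 * 1"
    by (intro mult_left_mono) auto
  then show ?thesis
    using excess_cube[of r] r by (simp add: r(2)[symmetric] algebra_simps power2_eq_square power3_eq_cube)
qed

text \<open>
  With \<open>w = r ^ 3\<close> and after division by \<open>1 - r\<close>, the claim is \<open>k * (1 + r + r\<^sup>2) \<le> r\<^sup>2\<close>.  If this
  holds at \<open>b\<close> then it holds at every larger \<open>r\<close>.
\<close>

lemma excess_near_1:
  assumes "w \<le> 1" "0 < k" "0 \<le> b" "b ^ 3 \<le> w" "k * (1 + b + b\<^sup>2) \<le> b\<^sup>2"
  shows "k * (1 - w) \<le> excess w"
proof -
  define r where "r = root 3 w"
  have w0: "0 \<le> w"
    using assms by (meson order_trans zero_le_power)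
  have r: "0 \<le> r" "r \<le> 1" "r ^ 3 = w"
    using assms w0 by (auto simp: r_def)
  have br: "b \<le> r"
    by (rule power_le_imp_le_base[of _ 2]) (use assms r in \<open>auto simp: eval_nat_numeral\<close>)
  have b: "0 < b"
  proof (rule ccontr)
    assume "\<not> 0 < b"
    then have "b = 0" using assms by simp
    then show False using assms by simp
  qed
  \<comment> \<open>The quotient \<open>(1 + r + r\<^sup>2) / r\<^sup>2\<close> decreases in \<open>r\<close>.\<close>
  have "k * (1 + r + r\<^sup>2) * b\<^sup>2 \<le> k * (1 + b + b\<^sup>2) * r\<^sup>2"
  proof -
    have "b\<^sup>2 \<le> r\<^sup>2" using br b by (intro power_mono) auto
    moreover have "(b * r) * b \<le> (b * r) * r" using br b r by (intro mult_left_mono) auto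
    ultimately have "(1 + r + r\<^sup>2) * b\<^sup>2 \<le> (1 + b + b\<^sup>2) * r\<^sup>2"
      by (simp add: algebra_simps power2_eq_square)
    then show ?thesis using assms by (simp add: mult.assoc)
  qed
  also have "\<dots> \<le> b\<^sup>2 * r\<^sup>2"
    using assms by (intro mult_right_mono) auto
  finally have "k * (1 + r + r\<^sup>2) \<le> r\<^sup>2"
    using b by (simp add: mult.commute)
  then have "(1 - r) * (k * (1 + r + r\<^sup>2)) \<le> (1 - r) * r\<^sup>2"
    using r by (intro mult_left_mono) auto
  then show ?thesis
    using excess_cube[of r] r by (simp add: r(3)[symmetric] algebra_simps power2_eq_square power3_eq_cube)
qed

text \<open>
  The quotient of \<open>2 * excess ((1 + y) / 2)\<close> by \<open>1 - \<bar>y\<bar>\<close> is least at \<open>y = 0\<close>, where it is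
  \<open>root 3 2 - 1\<close>, just above the constant \<open>0.2598\<close>.  Accordingly \<open>0.7936\<close> is just below the cube root of \<open>1/2\<close>.
\<close>

lemma excess_ge_any_angle:
  assumes "\<bar>y\<bar> \<le> 1"
  shows "2598/10000 * (1 - \<bar>y\<bar>) \<le> 2 * excess ((1 + y) / 2)"
proof (cases "0 \<le> y")
  case True
  have "2598/10000 * (1 - (1 + y) / 2) \<le> excess ((1 + y) / 2)"
    by (rule excess_near_1[where b = "7936/10000"])
      (use assms True in \<open>auto simp: power2_eq_square power3_eq_cube\<close>)
  then show ?thesis using True by (simp add: field_simps)
next
  case False
  have "2598/10000 * ((1 + y) / 2) \<le> excess ((1 + y) / 2)"
    by (rule excess_near_0) (use assms False in \<open>auto simp: power3_eq_cube\<close>)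
  then show ?thesis using False by (simp add: field_simps)
qed

text \<open>
  Here \<open>s\<close> tells whether the pair is expected to point in the same or in opposite directions, and
  the lower bound for \<open>s * y\<close> is \<open>cos (2 * a)\<close> where \<open>cos a = 1299/2000\<close>.  The binding case
  is \<open>s = -1\<close> at that angle.
\<close>

lemma excess_ge_aligned:
  assumes "s = 1 \<or> s = -1" "\<bar>y\<bar> \<le> 1" "2 * (1299/2000)\<^sup>2 - 1 \<le> s * y"
  shows "(1 - s * y) / 5 \<le> 2 * excess ((1 + y) / 2)"
proof (cases "s = 1")
  case True
  have "1/5 * (1 - (1 + y) / 2) \<le> excess ((1 + y) / 2)"
    by (rule excess_near_1[where b = "7/10"])
      (use assms True in \<open>auto simp: power2_eq_square power3_eq_cube\<close>)
  then show ?thesis using True by (simp add: field_simps)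
next
  case False
  then have s: "s = -1" using assms by simp
  have "1/5 * ((1 + y) / 2) \<le> excess ((1 + y) / 2)"
    by (rule excess_near_0) (use assms s in \<open>auto simp: power2_eq_square power3_eq_cube\<close>)
  then show ?thesis using s by (simp add: field_simps)
qed

section \<open>Odd numbers of unit vectors\<close>

text \<open>
  The sum of the signs alone is an odd integer, and replacing the weights \<open>c i\<close> by \<open>1\<close> changes the
  sum by at most \<open>\<Sum>i. 1 - c i\<close>.
\<close>

lemma odd_sign_sum:
  fixes s c :: "'n::finite \<Rightarrow> real"
  assumes s: "\<And>i. s i = 1 \<or> s i = -1" and c: "\<And>i. c i \<le> 1" and odd: "odd CARD('n)"
  shows "1 - (\<Sum>i\<in>UNIV. 1 - c i) \<le> \<bar>\<Sum>i\<in>UNIV. s i * c i\<bar>"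
proof -
  define M where "M = {i. s i = -1}"
  have "s i = 1 - 2 * indicator M i" for i
    using s[of i] by (auto simp: M_def indicator_def)
  then have "(\<Sum>i\<in>UNIV. s i) = real CARD('n) - 2 * (\<Sum>i\<in>UNIV. indicator M i)"
    by (simp add: sum_subtractf sum_distrib_left)
  also have "(\<Sum>i\<in>UNIV. indicator M i) = real (card M)"
    by (simp add: indicator_def)
  also have "real CARD('n) - 2 * real (card M) = of_int (int CARD('n) - 2 * int (card M))"
    by simp
  finally have S: "(\<Sum>i\<in>UNIV. s i) = of_int (int CARD('n) - 2 * int (card M))" .
  have "int CARD('n) - 2 * int (card M) \<noteq> 0"
    using odd by presburger
  then have "1 \<le> \<bar>int CARD('n) - 2 * int (card M)\<bar>" by linarith
  then have "1 \<le> \<bar>\<Sum>i\<in>UNIV. s i\<bar>"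
    unfolding S by linarith
  moreover have "\<bar>(\<Sum>i\<in>UNIV. s i) - (\<Sum>i\<in>UNIV. s i * c i)\<bar> \<le> (\<Sum>i\<in>UNIV. 1 - c i)"
  proof -
    have "\<bar>\<Sum>i\<in>UNIV. s i * (1 - c i)\<bar> \<le> (\<Sum>i\<in>UNIV. \<bar>s i * (1 - c i)\<bar>)"
      by (rule sum_abs)
    also have "\<dots> = (\<Sum>i\<in>UNIV. 1 - c i)"
    proof (rule sum.cong)
      show "\<bar>s i * (1 - c i)\<bar> = 1 - c i" for i
        using s[of i] c[of i] by auto
    qed simp
    finally show ?thesis by (simp add: algebra_simps sum_subtractf)
  qed
  ultimately show ?thesis by linarith
qed

lemma norm_sum_squared:
  fixes v :: "'n::finite \<Rightarrow> 'a::real_inner"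
  shows "(norm (\<Sum>i\<in>UNIV. v i))\<^sup>2 = (\<Sum>i\<in>UNIV. \<Sum>j\<in>UNIV. v i \<bullet> v j)"
  by (simp add: power2_norm_eq_inner inner_sum_left inner_sum_right) (rule sum.swap)

lemma maximal_signs:
  fixes v :: "'n::finite \<Rightarrow> 'a::real_inner"
  obtains s :: "'n \<Rightarrow> real" where "\<And>i. s i = 1 \<or> s i = -1"
    and "\<And>t. (\<And>i. t i = 1 \<or> t i = -1) \<Longrightarrow> norm (\<Sum>i\<in>UNIV. t i *\<^sub>R v i) \<le> norm (\<Sum>i\<in>UNIV. s i *\<^sub>R v i)"
proof -
  define T where "T = {t :: 'n \<Rightarrow> real. \<forall>i. t i = 1 \<or> t i = -1}"
  have "T \<subseteq> Pi\<^sub>E UNIV (\<lambda>_. {1, -1})"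
    by (auto simp: T_def)
  then have fin: "finite T"
    by (rule finite_subset) (auto intro: finite_PiE)
  have "(\<lambda>_. 1) \<in> T" by (auto simp: T_def)
  then have "T \<noteq> {}" by auto
  define f where "f t = norm (\<Sum>i\<in>UNIV. t i *\<^sub>R v i)" for t
  obtain s where "s \<in> T" "f s = Max (f ` T)"
    using obtains_MAX[OF fin \<open>T \<noteq> {}\<close>, of f] by metis
  moreover have "f t \<le> Max (f ` T)" if "t \<in> T" for t
    using fin that by simp
  ultimately have "s \<in> T" "\<forall>t\<in>T. f t \<le> f s" by auto
  then show ?thesis
    by (intro that[of s]) (auto simp: T_def f_def)
qed

text \<open>
  The two lower bounds for the sum \<open>H\<close> of excesses meet at \<open>D = 0.701\<close>: the bound \<open>far\<close> gives
  \<open>H \<ge> 0.2598 * 5 * D = 1.299 * D\<close>, which suffices once \<open>2 - D \<le> 1.299\<close>; and the bound \<open>near\<close>, with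
  constant \<open>1/5\<close>, is available as long as any two of the vectors \<open>s i *\<^sub>R v i\<close> have a sum of norm at least
  \<open>2 - D \<ge> 1.299\<close>.  The constant \<open>1/5\<close> is what the limit \<open>D = 0\<close> requires for \<open>N = 5\<close>.
\<close>

lemma excess_plus_resultant:
  fixes v :: "'n::finite \<Rightarrow> 'a::real_inner"
  assumes unit: "\<And>i. norm (v i) = 1" and odd: "odd CARD('n)" and N5: "5 \<le> CARD('n)"
  shows "1 \<le> (\<Sum>i\<in>UNIV. \<Sum>j\<in>UNIV. 2 * excess ((1 + v i \<bullet> v j) / 2)) + (norm (\<Sum>i\<in>UNIV. v i))\<^sup>2"
proof -
  define N where "N = real CARD('n)"
  define H where "H = (\<Sum>i\<in>UNIV. \<Sum>j\<in>UNIV. 2 * excess ((1 + v i \<bullet> v j) / 2))"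
  obtain s :: "'n \<Rightarrow> real" where s: "\<And>i. s i = 1 \<or> s i = -1"
    and smax: "\<And>t. (\<And>i. t i = 1 \<or> t i = -1) \<Longrightarrow> norm (\<Sum>i\<in>UNIV. t i *\<^sub>R v i) \<le> norm (\<Sum>i\<in>UNIV. s i *\<^sub>R v i)"
    using maximal_signs[of v] by blast
  define W where "W = (\<Sum>i\<in>UNIV. s i *\<^sub>R v i)"
  define D where "D = N - norm W"
  have N5': "5 \<le> N" using N5 by (simp add: N_def)
  have vv: "\<bar>v i \<bullet> v j\<bar> \<le> 1" for i j
    using Cauchy_Schwarz_ineq2[of "v i" "v j"] by (simp add: unit)
  have ss: "\<bar>s i\<bar> = 1" for i using s[of i] by auto

  \<comment> \<open>Competing signs: those that turn every \<open>v i\<close> towards \<open>v k\<close>.\<close>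
  have axis: "(\<Sum>i\<in>UNIV. \<bar>v i \<bullet> v k\<bar>) \<le> norm W" for k
  proof -
    define t where "t i = (if 0 \<le> v i \<bullet> v k then 1 else - 1 :: real)" for i
    have "(\<Sum>i\<in>UNIV. \<bar>v i \<bullet> v k\<bar>) = (\<Sum>i\<in>UNIV. t i *\<^sub>R v i) \<bullet> v k"
      unfolding inner_sum_left by (intro sum.cong) (auto simp: t_def)
    also have "\<dots> \<le> norm (\<Sum>i\<in>UNIV. t i *\<^sub>R v i) * norm (v k)"
      by (rule norm_cauchy_schwarz)
    also have "\<dots> \<le> norm W"
      unfolding W_def unit by (simp, rule smax) (auto simp: t_def)
    finally show ?thesis .
  qed
  have "N * D \<le> (\<Sum>k\<in>UNIV. \<Sum>i\<in>UNIV. 1 - \<bar>v k \<bullet> v i\<bar>)"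
  proof -
    have "(\<Sum>k\<in>(UNIV::'n set). D) \<le> (\<Sum>k\<in>UNIV. \<Sum>i\<in>UNIV. 1 - \<bar>v k \<bullet> v i\<bar>)"
    proof (rule sum_mono)
      show "D \<le> (\<Sum>i\<in>UNIV. 1 - \<bar>v k \<bullet> v i\<bar>)" for k
        using axis[of k] by (simp add: sum_subtractf D_def N_def inner_commute)
    qed
    then show ?thesis by (simp add: N_def)
  qed
  then have "2598/10000 * (N * D) \<le> 2598/10000 * (\<Sum>k\<in>UNIV. \<Sum>i\<in>UNIV. 1 - \<bar>v k \<bullet> v i\<bar>)"
    by (rule mult_left_mono) simp
  also have "\<dots> \<le> H"
    unfolding H_def sum_distrib_left using excess_ge_any_angle[OF vv]
    by (intro sum_mono) simp
  finally have far: "2598/10000 * (N * D) \<le> H" .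

  have "norm W \<le> (\<Sum>i\<in>UNIV. norm (s i *\<^sub>R v i))"
    unfolding W_def by (rule norm_sum)
  then have D0: "0 \<le> D"
    by (simp add: unit ss D_def N_def)
  have ND: "1299/1000 * D \<le> H"
  proof -
    have "5 * D \<le> N * D" using N5' D0 by (rule mult_right_mono)
    then show ?thesis using far by linarith
  qed
  show ?thesis
  proof (cases "D \<le> 1")
    case False
    with ND have "1 \<le> H" by linarith
    then show ?thesis
      unfolding H_def[symmetric] by (simp add: add_increasing2)
  next
    case D1: True
    have W0: "0 < norm W" using D1 N5' unfolding D_def by linarith
    define e where "e = (1 / norm W) *\<^sub>R W"
    have e1: "norm e = 1" using W0 by (simp add: e_def)
    define c where "c i = s i * (v i \<bullet> e)" for i
    have c1: "c i \<le> 1" for i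
    proof -
      have "\<bar>c i\<bar> \<le> 1"
        using Cauchy_Schwarz_ineq2[of "v i" e] by (simp add: c_def abs_mult ss unit e1)
      then show ?thesis by simp
    qed
    have "(\<Sum>i\<in>UNIV. c i) = W \<bullet> e"
      by (simp add: c_def W_def inner_sum_left)
    also have "\<dots> = norm W"
      using W0 by (simp add: e_def power2_norm_eq_inner[symmetric] power2_eq_square)
    finally have csum: "(\<Sum>i\<in>UNIV. 1 - c i) = D"
      by (simp add: sum_subtractf D_def N_def)
    have "1 - D \<le> \<bar>\<Sum>i\<in>UNIV. s i * c i\<bar>"
      using odd_sign_sum[of s c, OF s c1 odd] csum by simp
    also have "(\<Sum>i\<in>UNIV. s i * c i) = (\<Sum>i\<in>UNIV. v i) \<bullet> e"
      unfolding inner_sum_left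
    proof (rule sum.cong)
      show "s i * c i = v i \<bullet> e" for i using s[of i] by (auto simp: c_def)
    qed simp
    also have "\<bar>(\<Sum>i\<in>UNIV. v i) \<bullet> e\<bar> \<le> norm (\<Sum>i\<in>UNIV. v i)"
      using Cauchy_Schwarz_ineq2[of "\<Sum>i\<in>UNIV. v i" e] by (simp add: e1)
    finally have "(1 - D)\<^sup>2 \<le> (norm (\<Sum>i\<in>UNIV. v i))\<^sup>2"
      using D1 by (intro power_mono) auto
    moreover have "D * (2 - D) \<le> H"
    proof (cases "701/1000 \<le> D")
      case True
      then have "D * (2 - D) \<le> D * (1299/1000)"
        using D0 by (intro mult_left_mono) auto
      then show ?thesis using ND by linarith
    next
      case False
      have near: "(1 - (s i * s j) * (v i \<bullet> v j)) / 5 \<le> 2 * excess ((1 + v i \<bullet> v j) / 2)" for i j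
      proof (rule excess_ge_aligned[OF _ vv])
        show "s i * s j = 1 \<or> s i * s j = - 1" using s[of i] s[of j] by auto
        show "2 * (1299/2000)\<^sup>2 - 1 \<le> s i * s j * (v i \<bullet> v j)"
        proof (cases "i = j")
          case True
          then show ?thesis
            using s[of i] by (auto simp: power2_norm_eq_inner[symmetric] unit power2_eq_square)
        next
          case False
          \<comment> \<open>The two defects are part of the total defect \<open>D\<close>, so both vectors are close to \<open>e\<close>.\<close>
          have "(\<Sum>l\<in>{i, j}. 1 - c l) \<le> (\<Sum>l\<in>UNIV. 1 - c l)"
            by (rule sum_mono2) (auto simp: c1)
          then have "2 - D \<le> c i + c j"
            using False csum by simp
          also have "c i + c j = (s i *\<^sub>R v i + s j *\<^sub>R v j) \<bullet> e"
            by (simp add: c_def inner_add_left)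
          also have "\<dots> \<le> norm (s i *\<^sub>R v i + s j *\<^sub>R v j)"
            using norm_cauchy_schwarz[of "s i *\<^sub>R v i + s j *\<^sub>R v j" e] by (simp add: e1)
          finally have "2 * (1299/2000) \<le> norm (s i *\<^sub>R v i + s j *\<^sub>R v j)"
            using \<open>\<not> 701/1000 \<le> D\<close> by simp
          then have "(2 * (1299/2000))\<^sup>2 \<le> (norm (s i *\<^sub>R v i + s j *\<^sub>R v j))\<^sup>2"
            by (intro power_mono) auto
          also have "\<dots> = 2 + 2 * (s i * s j * (v i \<bullet> v j))"
          proof -
            have "v l \<bullet> v l = 1" "s l * s l = 1" for l
              using s[of l] unit[of l] by (auto simp: norm_eq_1)
            then show ?thesis
              by (simp add: power2_norm_eq_inner inner_add_left inner_add_right inner_commute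
                  mult.assoc[symmetric])
          qed
          finally show ?thesis by (simp add: power2_eq_square)
        qed
      qed
      have "(norm W)\<^sup>2 = (\<Sum>i\<in>UNIV. \<Sum>j\<in>UNIV. s i * s j * (v i \<bullet> v j))"
        unfolding W_def norm_sum_squared by (simp add: mult.left_commute mult.assoc)
      then have "(\<Sum>i\<in>UNIV. \<Sum>j\<in>UNIV. 1 - s i * s j * (v i \<bullet> v j)) = N\<^sup>2 - (norm W)\<^sup>2"
        by (simp add: sum_subtractf N_def power2_eq_square)
      also have "\<dots> = D * (2 * N - D)"
        by (simp add: D_def algebra_simps power2_eq_square)
      finally have "D * (2 * N - D) / 5 = (\<Sum>i\<in>UNIV. \<Sum>j\<in>UNIV. (1 - s i * s j * (v i \<bullet> v j)) / 5)"
        by (simp add: sum_divide_distrib[symmetric])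
      also have "\<dots> \<le> H"
        unfolding H_def by (intro sum_mono near)
      finally have "D * ((2 * N - D) / 5) \<le> H" by simp
      moreover have "D * (2 - D) \<le> D * ((2 * N - D) / 5)"
        using D0 N5' by (intro mult_left_mono) auto
      ultimately show ?thesis by linarith
    qed
    moreover have "(1 - D)\<^sup>2 + D * (2 - D) = 1"
      by (simp add: power2_eq_square algebra_simps)
    ultimately show ?thesis
      unfolding H_def[symmetric] by linarith
  qed
qed

section \<open>Three lines in the plane\<close>

text \<open>
  Let \<open>S\<close> be the sum of fourth powers, \<open>a = A\<^sup>2\<close>, and suppose \<open>S < 1\<close>.  Taking out the largest square
  bounds the sixth powers by \<open>a * S < a\<close>.  Since
  \<open>2 * (B * C)\<^sup>2 \<le> B ^ 4 + C ^ 4 \<le> 1 - a\<^sup>2\<close>, the mixed term is at most \<open>1 - a\<close>; after squaring, this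
  amounts to \<open>a ^ 3 * (1 - a) * (1 + a) ^ 3 \<le> 2\<close>.  Together the two stay below \<open>1\<close>.
\<close>

lemma sum_fourth_powers_ge_1_ordered:
  fixes A B C :: real
  assumes nn: "0 \<le> A" "0 \<le> B" "0 \<le> C" and max: "B \<le> A" "C \<le> A"
    and gram: "1 \<le> A ^ 6 + B ^ 6 + C ^ 6 + 2 * (A * B * C) ^ 3"
  shows "1 \<le> A ^ 4 + B ^ 4 + C ^ 4"
proof (rule ccontr)
  define S where "S = A ^ 4 + B ^ 4 + C ^ 4"
  define a where "a = A\<^sup>2"
  define w where "w = (B * C)\<^sup>2"
  assume "\<not> 1 \<le> A ^ 4 + B ^ 4 + C ^ 4"
  then have S1: "S < 1" by (simp add: S_def)
  have a0: "0 < a"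
  proof (rule ccontr)
    assume "\<not> 0 < a"
    then have "A = 0" by (auto simp: a_def)
    then have "B = 0" "C = 0" using nn max by auto
    with \<open>A = 0\<close> gram show False by simp
  qed
  have a4: "A ^ 4 = a\<^sup>2" by (simp add: a_def)
  have "a\<^sup>2 \<le> S" using a4 by (simp add: S_def)
  then have "a\<^sup>2 < 1\<^sup>2" using S1 by simp
  then have a1: "a < 1" by (rule power_less_imp_less_base) simp
  have w0: "0 \<le> w" by (simp add: w_def)
  have "0 \<le> (B\<^sup>2 - C\<^sup>2)\<^sup>2" by simp
  then have "2 * w \<le> B ^ 4 + C ^ 4"
    by (simp add: w_def power2_eq_square power4_eq_xxxx algebra_simps)
  then have w: "2 * w \<le> 1 - a\<^sup>2" using S1 a4 by (simp add: S_def)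
  have "(2 * w) ^ 3 \<le> (1 - a\<^sup>2) ^ 3"
    using w w0 by (intro power_mono) auto
  then have "a ^ 3 * (2 * w) ^ 3 \<le> a ^ 3 * (1 - a\<^sup>2) ^ 3"
    using a0 by (intro mult_left_mono) auto
  also have "\<dots> = (1 - a)\<^sup>2 * ((a * (1 - a)) * (a * (1 + a))\<^sup>2 * (1 + a))"
    by (simp add: power2_eq_square power3_eq_cube algebra_simps)
  also have "\<dots> \<le> (1 - a)\<^sup>2 * (1 / 4 * 2\<^sup>2 * 2)"
  proof (intro mult_left_mono mult_mono power_mono)
    have "0 \<le> (1 - 2 * a)\<^sup>2" by simp
    then show "a * (1 - a) \<le> 1 / 4" by (simp add: power2_eq_square algebra_simps)
    show "a * (1 + a) \<le> 2"
      using mult_mono[of a 1 "1 + a" 2] a0 a1 by simp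
  qed (use a0 a1 in auto)
  finally have "4 * (a ^ 3 * w ^ 3) \<le> (1 - a)\<^sup>2" by (simp add: power_mult_distrib)
  moreover have "(2 * (A * B * C) ^ 3)\<^sup>2 = 4 * (a ^ 3 * w ^ 3)"
    by (simp add: a_def w_def power_mult_distrib power2_eq_square power3_eq_cube mult_ac)
  ultimately have "(2 * (A * B * C) ^ 3)\<^sup>2 \<le> (1 - a)\<^sup>2" by linarith
  then have "2 * (A * B * C) ^ 3 \<le> 1 - a"
    by (rule power2_le_imp_le) (use a1 in linarith)
  moreover have "A ^ 6 + B ^ 6 + C ^ 6 \<le> a * S"
  proof -
    have "B\<^sup>2 * B ^ 4 \<le> a * B ^ 4" "C\<^sup>2 * C ^ 4 \<le> a * C ^ 4"
      unfolding a_def using nn max by (intro mult_right_mono power_mono; simp)+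
    then show ?thesis
      by (simp add: S_def a_def algebra_simps flip: power_add)
  qed
  moreover have "a * S < a * 1" using a0 S1 by (intro mult_strict_left_mono)
  ultimately show False using gram by simp
qed

lemma sum_fourth_powers_ge_1:
  fixes A B C :: real
  assumes nn: "0 \<le> A" "0 \<le> B" "0 \<le> C"
    and gram: "1 \<le> A ^ 6 + B ^ 6 + C ^ 6 + 2 * (A * B * C) ^ 3"
  shows "1 \<le> A ^ 4 + B ^ 4 + C ^ 4"
proof -
  consider "B \<le> A" "C \<le> A" | "A \<le> B" "C \<le> B" | "A \<le> C" "B \<le> C" by linarith
  then show ?thesis
  proof cases
    case 1
    then show ?thesis using sum_fourth_powers_ge_1_ordered[of A B C] assms by simp
  next
    case 2
    then show ?thesis using sum_fourth_powers_ge_1_ordered[of B A C] assms by (simp add: ac_simps)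
  next
    case 3
    then show ?thesis using sum_fourth_powers_ge_1_ordered[of C A B] assms by (simp add: ac_simps)
  qed
qed

lemma plane_gram_determinant:
  fixes a b c :: "real ^ 2"
  assumes "norm a = 1" "norm b = 1" "norm c = 1"
  shows "(a \<bullet> b)\<^sup>2 + (b \<bullet> c)\<^sup>2 + (a \<bullet> c)\<^sup>2 = 1 + 2 * (a \<bullet> b) * (b \<bullet> c) * (a \<bullet> c)"
proof -
  have "(a \<bullet> b)\<^sup>2 * (c \<bullet> c) + (b \<bullet> c)\<^sup>2 * (a \<bullet> a) + (a \<bullet> c)\<^sup>2 * (b \<bullet> b)
      = (a \<bullet> a) * (b \<bullet> b) * (c \<bullet> c) + 2 * (a \<bullet> b) * (b \<bullet> c) * (a \<bullet> c)"
    unfolding inner_vec_def sum_2 inner_real_def power2_eq_square by algebra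
  moreover have "a \<bullet> a = 1" "b \<bullet> b = 1" "c \<bullet> c = 1"
    using assms by (auto simp: norm_eq_1)
  ultimately show ?thesis by simp
qed

text \<open>
  The Gram identity yields \<open>1 \<le> X\<^sup>2 + Y\<^sup>2 + Z\<^sup>2 + 2 * X * Y * Z\<close> for the absolute values of the three inner
  products; the real inequality above is applied to their cube roots.
\<close>

lemma three_lines:
  fixes a b c :: "real ^ 2"
  assumes "norm a = 1" "norm b = 1" "norm c = 1"
  shows "1 \<le> (root 3 ((a \<bullet> b)\<^sup>2))\<^sup>2 + (root 3 ((b \<bullet> c)\<^sup>2))\<^sup>2 + (root 3 ((a \<bullet> c)\<^sup>2))\<^sup>2"
proof -
  define r where "r t = root 3 \<bar>t\<bar>" for t :: real
  have r0: "0 \<le> r t" and r3: "r t ^ 3 = \<bar>t\<bar>" for t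
    by (auto simp: r_def)
  have r6: "r t ^ 6 = t\<^sup>2" for t
  proof -
    have "r t ^ 6 = (r t ^ 3)\<^sup>2" by (simp flip: power_mult)
    then show ?thesis by (simp add: r3)
  qed
  have r4: "(root 3 (t\<^sup>2))\<^sup>2 = r t ^ 4" for t
  proof -
    have "root 3 (t\<^sup>2) = (r t)\<^sup>2"
      unfolding r_def by (subst real_root_power[symmetric]) auto
    then show ?thesis by simp
  qed
  have "1 \<le> (a \<bullet> b)\<^sup>2 + (b \<bullet> c)\<^sup>2 + (a \<bullet> c)\<^sup>2 + 2 * \<bar>(a \<bullet> b) * (b \<bullet> c) * (a \<bullet> c)\<bar>"
    using plane_gram_determinant[OF assms] abs_ge_minus_self[of "(a \<bullet> b) * (b \<bullet> c) * (a \<bullet> c)"] by linarith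
  then have "1 \<le> r (a \<bullet> b) ^ 4 + r (b \<bullet> c) ^ 4 + r (a \<bullet> c) ^ 4"
    by (intro sum_fourth_powers_ge_1 r0) (simp add: r6 r3 power_mult_distrib abs_mult)
  then show ?thesis by (simp add: r4)
qed

section \<open>Doubling angles and the frame energy\<close>

lemma double_angle_inner:
  fixes a b :: "real ^ 2"
  assumes "norm a = 1" "norm b = 1"
  shows "(Complex (a$1) (a$2))\<^sup>2 \<bullet> (Complex (b$1) (b$2))\<^sup>2 = 2 * (a \<bullet> b)\<^sup>2 - 1"
proof -
  have "(a$1)\<^sup>2 + (a$2)\<^sup>2 = 1" "(b$1)\<^sup>2 + (b$2)\<^sup>2 = 1"
    using assms by (auto simp: norm_eq_1 inner_vec_def sum_2 power2_eq_square)
  then show ?thesis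
    unfolding inner_vec_def sum_2 inner_real_def inner_complex_def power2_eq_square
    by (simp only: complex.sel times_complex.sel) algebra
qed

lemma energy_four_thirds:
  fixes x :: "'n::finite \<Rightarrow> real ^ 2"
  assumes unit: "\<And>i. norm (x i) = 1"
  defines "S \<equiv> \<Sum>i\<in>UNIV. \<Sum>j\<in>UNIV. (root 3 ((x i \<bullet> x j)\<^sup>2))\<^sup>2"
  shows "(real CARD('n))\<^sup>2 / 2 \<le> S" and "odd CARD('n) \<Longrightarrow> ((real CARD('n))\<^sup>2 + 1) / 2 \<le> S"
proof -
  \<comment> \<open>Squaring a complex number doubles its argument.\<close>
  define v where "v i = (Complex (x i $ 1) (x i $ 2))\<^sup>2" for i
  have vx: "(x i \<bullet> x j)\<^sup>2 = (1 + v i \<bullet> v j) / 2" for i j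
    using double_angle_inner[OF unit unit, of i j] by (simp add: v_def)
  have xx: "x i \<bullet> x i = 1" for i using unit[of i] by (simp add: norm_eq_1)
  have vu: "norm (v i) = 1" for i
    using vx[of i i] by (simp add: norm_eq_1 xx)
  define H where "H = (\<Sum>i\<in>UNIV. \<Sum>j\<in>UNIV. 2 * excess ((1 + v i \<bullet> v j) / 2))"
  have "2 * S = (\<Sum>i\<in>UNIV. \<Sum>j\<in>UNIV. 2 * excess ((1 + v i \<bullet> v j) / 2) + (1 + v i \<bullet> v j))"
    unfolding S_def sum_distrib_left by (intro sum.cong refl) (simp add: excess_def vx)
  then have S: "2 * S = H + (real CARD('n))\<^sup>2 + (norm (\<Sum>i\<in>UNIV. v i))\<^sup>2"
    unfolding norm_sum_squared H_def by (simp add: sum.distrib power2_eq_square)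
  have "0 \<le> excess ((1 + v i \<bullet> v j) / 2)" for i j
    using Cauchy_Schwarz_ineq2[of "v i" "v j"] by (intro excess_nonneg) (auto simp: vu)
  then have "0 \<le> H"
    unfolding H_def by (intro sum_nonneg) simp
  then show "(real CARD('n))\<^sup>2 / 2 \<le> S"
    using S zero_le_power2[of "norm (\<Sum>i\<in>UNIV. v i)"] by linarith
  assume odd: "odd CARD('n)"
  have "n = 1 \<or> n = 3 \<or> 5 \<le> n" if "odd n" for n :: nat
    using that by presburger
  from this[OF odd] consider "CARD('n) = 1" | "CARD('n) = 3" | "5 \<le> CARD('n)" by blast
  then show "((real CARD('n))\<^sup>2 + 1) / 2 \<le> S"
  proof cases
    case 1
    then obtain a where U: "(UNIV :: 'n set) = {a}" by (auto simp: card_1_singleton_iff)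
    show ?thesis unfolding S_def U by (simp add: xx)
  next
    case 2
    then obtain a b c where U: "(UNIV :: 'n set) = {a, b, c}" and ne: "a \<noteq> b" "b \<noteq> c" "a \<noteq> c"
      by (auto simp: card_3_iff)
    then show ?thesis
      using three_lines[OF unit unit unit, of a b c]
      unfolding S_def U by (simp add: xx inner_commute[of "x b" "x a"]
          inner_commute[of "x c" "x a"] inner_commute[of "x c" "x b"])
  next
    case 3
    then have "1 \<le> H + (norm (\<Sum>i\<in>UNIV. v i))\<^sup>2"
      unfolding H_def using vu odd by (intro excess_plus_resultant)
    then have "(real CARD('n))\<^sup>2 + 1 \<le> 2 * S"
      unfolding S by simp
    then show ?thesis by simp
  qed
qed

lemma root_le_abs_powr:
  fixes t p :: real
  assumes "\<bar>t\<bar> \<le> 1" "0 < p" "p \<le> 4 / 3"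
  shows "(root 3 (t\<^sup>2))\<^sup>2 \<le> \<bar>t\<bar> powr p"
proof (cases "t = 0")
  case False
  have "root 3 (t\<^sup>2) = (\<bar>t\<bar> powr 2) powr (1 / 3)"
    using False by (simp add: root_powr_inverse)
  then have "root 3 (t\<^sup>2) = \<bar>t\<bar> powr (2 / 3)"
    by (simp only: powr_powr) simp
  then have "(root 3 (t\<^sup>2))\<^sup>2 = \<bar>t\<bar> powr (4 / 3)"
    by (simp add: power2_eq_square flip: powr_add)
  also have "\<dots> \<le> \<bar>t\<bar> powr p"
    using assms False by (intro powr_mono') auto
  finally show ?thesis .
qed simp

lemma frame_energy_ge:
  fixes x :: "'n::finite \<Rightarrow> real ^ 2"
  assumes unit: "\<And>i. norm (x i) = 1" and p: "0 < p" "p \<le> 4 / 3"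
  shows "(\<Sum>i\<in>UNIV. \<Sum>j\<in>UNIV. (root 3 ((x i \<bullet> x j)\<^sup>2))\<^sup>2) - real CARD('n)
    \<le> frame_energy p (gram_matrix x)"
proof -
  define g where "g = (\<lambda>(i, j). (root 3 ((x i \<bullet> x j)\<^sup>2))\<^sup>2)"
  define diag where "diag = (\<lambda>i :: 'n. (i, i)) ` UNIV"
  have xx: "x i \<bullet> x i = 1" for i using unit[of i] by (simp add: norm_eq_1)
  have "sum g diag = real CARD('n)"
    unfolding diag_def by (subst sum.reindex) (auto simp: inj_on_def g_def xx)
  moreover have "sum g (UNIV \<times> UNIV) = sum g {(i, j). i \<noteq> j} + sum g diag"
    by (subst sum.union_disjoint[symmetric]) (auto simp: diag_def intro!: sum.cong)
  moreover have "sum g (UNIV \<times> UNIV) = (\<Sum>i\<in>UNIV. \<Sum>j\<in>UNIV. (root 3 ((x i \<bullet> x j)\<^sup>2))\<^sup>2)"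
    by (simp add: sum.cartesian_product g_def)
  moreover have "sum g {(i, j). i \<noteq> j} \<le> frame_energy p (gram_matrix x)"
    unfolding frame_energy_def
  proof (intro sum_mono)
    have "\<bar>x i \<bullet> x j\<bar> \<le> 1" for i j
      using Cauchy_Schwarz_ineq2[of "x i" "x j"] by (simp add: unit)
    then show "g ij \<le> (case ij of (i, j) \<Rightarrow> \<bar>gram_matrix x $ i $ j\<bar> powr p)" for ij
      using p by (auto simp: g_def gram_matrix_def intro!: root_le_abs_powr split: prod.split)
  qed
  ultimately show ?thesis by linarith
qed

theorem theorem4p2:
  fixes x :: "'n::finite \<Rightarrow> real ^ 2" and N :: nat and p :: real
  assumes "N = CARD('n)"
    and "\<And>i. norm (x i) = 1"
    and "0 < p" and "p \<le> 13 / 10"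
  shows "(even N \<longrightarrow> frame_energy p (gram_matrix x) \<ge> real N * (real N - 2) / 2) \<and>
         (odd N \<longrightarrow> frame_energy p (gram_matrix x) \<ge> (real N - 1)\<^sup>2 / 2)"
proof -
  define S where "S = (\<Sum>i\<in>UNIV. \<Sum>j\<in>UNIV. (root 3 ((x i \<bullet> x j)\<^sup>2))\<^sup>2)"
  have "S - real N \<le> frame_energy p (gram_matrix x)"
    unfolding S_def using frame_energy_ge[of x p] assms by simp
  moreover have "(real N)\<^sup>2 / 2 \<le> S" and "odd N \<Longrightarrow> ((real N)\<^sup>2 + 1) / 2 \<le> S"
    unfolding S_def using energy_four_thirds[of x] assms by simp_all
  moreover have "real N * (real N - 2) / 2 = (real N)\<^sup>2 / 2 - real N"
    and "(real N - 1)\<^sup>2 / 2 = ((real N)\<^sup>2 + 1) / 2 - real N"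
    by (simp_all add: power2_eq_square field_simps)
  ultimately show ?thesis by (intro conjI impI) linarith+
qed

end
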